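(* Let $\alpha>1$ be a real number. Then $\alpha\notin\mathcal{Z}^\star$ if and only if there are infinitely many integers $r\geq 1$ for which there exist integers $k_1\geq 2$, $k_2,\dots,k_r\geq 1$ such that $$\left|\alpha-\zeta^\star(k_1,\dots,k_r)\right|<\sum_{n_1\geq\cdots\geq n_r\geq n_{r+1}\geq 2}\frac{1}{n_1^{k_1}\cdots n_r^{k_r}\,n_{r+1}}.$$
   Context: For integers $r\geq 1$, $k_1\geq 2$ and $k_2,\dots,k_r\geq 1$, the multiple zeta-star value is $$\zeta^\star(k_1,\dots,k_r)=\sum_{n_1\geq\cdots\geq n_r\geq 1}\frac{1}{n_1^{k_1}\cdots n_r^{k_r}},$$ where the sum is over integers. $\mathcal{Z}^\star\subset\mathbb{R}$ denotes the set of all multiple zeta-star values (over all $r\geq1$ and all such $(k_1,\dots,k_r)$). The paper phrases the condition as: the inequality holds "for infinitely many $r,k_1,\dots,k_r$ with $r\to+\infty$", i.e. it has solutions with arbitrarily large $r$. The summation on the right-hand side is over integers $n_1\geq\cdots\geq n_{r+1}\geq 2$; it equals $\zeta^\star(k_1,\dots,k_r,1)-\zeta^\star(k_1,\dots,k_r)$. *)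

theory Defs
  imports "HOL-Analysis.Analysis"
begin

text \<open>
  A tuple \<open>(k\<^sub>1, \<dots>, k\<^sub>r)\<close> is a list of length \<open>r\<close>, so \<open>k\<^sub>1\<close> is the head of the list and
  \<open>k\<^sub>i\<close> is the entry at position \<open>i - 1\<close>.
\<close>

definition admissible :: "nat list \<Rightarrow> bool" where
  "admissible ks \<longleftrightarrow> ks \<noteq> [] \<and> hd ks \<ge> 2 \<and> (\<forall>k\<in>set ks. k \<ge> 1)"

definition noninc_tuples :: "nat \<Rightarrow> nat \<Rightarrow> nat list set" where
  "noninc_tuples m r = {ns. length ns = r \<and> sorted_wrt (\<ge>) ns \<and> (\<forall>n\<in>set ns. n \<ge> m)}"

text \<open>
  The sum of \<open>1 / (n\<^sub>1^k\<^sub>1 \<cdots> n\<^sub>r^k\<^sub>r)\<close> over all \<open>n\<^sub>1 \<ge> \<dots> \<ge> n\<^sub>r \<ge> m\<close>. All terms are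
  nonnegative, so the unordered sum is the usual one; it converges when \<open>ks\<close> is admissible
  and \<open>m \<ge> 1\<close>.
\<close>

definition star_sum :: "nat \<Rightarrow> nat list \<Rightarrow> real" where
  "star_sum m ks =
     (\<Sum>\<^sub>\<infinity>ns\<in>noninc_tuples m (length ks). 1 / (\<Prod>i<length ks. real (ns ! i) ^ (ks ! i)))"

definition zeta_star :: "nat list \<Rightarrow> real" where
  "zeta_star ks = star_sum 1 ks"

definition zeta_star_values :: "real set" where
  "zeta_star_values = {zeta_star ks | ks. admissible ks}"

end

theory Submission
  imports Defs "HOL-Library.Sublist"
begin

text \<open>
  Appending ones to \<open>(k\<^sub>1, \<dots>, k\<^sub>r + 1)\<close> lets \<open>\<zeta>\<^sup>\<star>\<close> increase to \<open>\<zeta>\<^sup>\<star>(k\<^sub>1, \<dots>, k\<^sub>r)\<close> (to \<open>\<infinity>\<close> if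
  \<open>r = k\<^sub>1 = 1\<close>), so the values of all tuples with a given prefix fill an interval and
  intervals are ordered lexicographically, smaller digits giving larger values. The right-hand
  side of the inequality is the increment caused by one more digit \<open>1\<close>.

  If \<open>\<alpha>\<close> is not a value, its greedy expansion cannot end in ones, and every digit larger
  than \<open>1\<close> says that \<open>\<alpha>\<close> lies between \<open>\<zeta>\<^sup>\<star>(k\<^sub>1, \<dots>, k\<^sub>r)\<close> and \<open>\<zeta>\<^sup>\<star>(k\<^sub>1, \<dots>, k\<^sub>r, 1)\<close>.

  If \<open>\<alpha> = \<zeta>\<^sup>\<star>(l)\<close>, a tuple \<open>k\<close> longer than \<open>l\<close> that satisfies the inequality must have
  \<open>\<zeta>\<^sup>\<star>(k) \<ge> \<alpha>\<close>, and then extends one of finitely many \<open>c\<close> with \<open>\<zeta>\<^sup>\<star>(c) \<ge> \<alpha>\<close>. For fixed \<open>c\<close>, the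
  ratio of the increment of \<open>k = (c, m)\<close> to \<open>\<zeta>\<^sup>\<star>(c, m) - \<zeta>\<^sup>\<star>(c)\<close> is by Chebyshev's inequality
  largest when \<open>m\<close> consists of ones, and there it eventually drops to at most \<open>1\<close>, because the
  increments are bounded by \<open>1\<close>.
\<close>

section \<open>Truncated nested sums\<close>

declare One_nat_def [simp del]

text \<open>The nested sum over
  \<open>n \<ge> n\<^sub>1 \<ge> \<dots> \<ge> n\<^sub>r \<ge> m\<close>, with a weight
  \<open>f\<close> on the innermost index. Keeping \<open>f\<close> free turns concatenation of
  tuples into composition and lets the lower bound change along the tuple.\<close>

primrec chain_sum :: "nat \<Rightarrow> nat list \<Rightarrow> (nat \<Rightarrow> real) \<Rightarrow> nat \<Rightarrow> real" where
  "chain_sum m [] f n = f n"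
| "chain_sum m (k # ks) f n = (\<Sum>j=m..n. chain_sum m ks f j / real j ^ k)"

lemma chain_sum_Nil [simp]: "chain_sum m [] f = f"
  by (simp add: fun_eq_iff)

lemma chain_sum_append: "chain_sum m (ks @ ls) f n = chain_sum m ks (chain_sum m ls f) n"
  by (induction ks arbitrary: n) auto

lemma chain_sum_mono:
  assumes "\<And>j. j \<ge> m \<Longrightarrow> f j \<le> g j" and "n \<ge> m"
  shows "chain_sum m ks f n \<le> chain_sum m ks g n"
  using assms(2) by (induction ks arbitrary: n) (auto intro!: sum_mono divide_right_mono assms(1))

lemma chain_sum_cong:
  assumes "\<And>j. j \<ge> m \<Longrightarrow> f j = g j" and "n \<ge> m"
  shows "chain_sum m ks f n = chain_sum m ks g n"
  using assms(2) by (induction ks arbitrary: n) (auto intro!: sum.cong assms(1))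

lemma chain_sum_scale: "chain_sum m ks (\<lambda>j. a * f j) n = a * chain_sum m ks f n"
  by (induction ks arbitrary: n) (auto simp: sum_distrib_left)

lemma chain_sum_nonneg:
  assumes "\<And>j. f j \<ge> 0"
  shows "chain_sum m ks f n \<ge> 0"
  by (induction ks arbitrary: n) (auto intro!: sum_nonneg assms)

lemma chain_sum_pos:
  assumes "m \<ge> 1" and "\<And>j. j \<ge> m \<Longrightarrow> f j > 0" and "n \<ge> m"
  shows "chain_sum m ks f n > 0"
  using assms(3) by (induction ks arbitrary: n) (use assms(1,2) in \<open>auto intro!: sum_pos\<close>)

lemma incseq_chain_sum:
  assumes "\<And>j. f j \<ge> 0" and "ks \<noteq> []"
  shows "incseq (chain_sum m ks f)"
  using assms(2)
  by (cases ks) (auto simp: incseq_def intro!: sum_mono2 divide_nonneg_nonneg chain_sum_nonneg assms(1))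

lemma incseq_chain_sum_1: "incseq (chain_sum m ks (\<lambda>_. 1))"
proof (cases "ks = []")
  case True
  then show ?thesis by (simp add: incseq_def)
next
  case False
  then show ?thesis by (intro incseq_chain_sum) auto
qed

lemma chain_sum_tendsto:
  assumes "\<And>j. j \<ge> m \<Longrightarrow> (\<lambda>t. F t j) \<longlonglongrightarrow> f j" and "n \<ge> m" and "m \<ge> 1"
  shows "(\<lambda>t. chain_sum m ks (F t) n) \<longlonglongrightarrow> chain_sum m ks f n"
  using assms(2) by (induction ks arbitrary: n) (use assms(1,3) in \<open>auto intro!: tendsto_intros\<close>)

lemma chain_sum_at_1: "chain_sum 1 ks (\<lambda>_. 1) 1 = 1"
  by (induction ks) auto

text \<open>Split by the index belonging to \<open>x\<close>. If it is 1, all later indices are 1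
  and only the sum for \<open>c\<close> remains. Otherwise it and all indices of \<open>c\<close>
  are at least 2, while those of \<open>ks\<close> still start at 1.\<close>

lemma chain_sum_split:
  assumes "n \<ge> 1"
  shows "chain_sum 1 (c @ x # ks) (\<lambda>_. 1) n =
    chain_sum 1 c (\<lambda>_. 1) n + chain_sum 2 (c @ [x]) (chain_sum 1 ks (\<lambda>_. 1)) n"
  using assms
proof (induction c arbitrary: n)
  case Nil
  have "{1..n} = insert 1 {2..n}" using Nil by auto
  then show ?case by (simp add: chain_sum_at_1)
next
  case (Cons a c)
  let ?g = "chain_sum 2 (c @ [x]) (chain_sum 1 ks (\<lambda>_. 1))"
  have 1: "{1..n} = insert 1 {2..n}" using Cons.prems by auto
  have 2: "?g 1 = 0" by (cases c) auto
  have "chain_sum 1 ((a # c) @ x # ks) (\<lambda>_. 1) n =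
      (\<Sum>j=1..n. chain_sum 1 c (\<lambda>_. 1) j / real j ^ a + ?g j / real j ^ a)"
    by (auto simp: Cons.IH add_divide_distrib intro!: sum.cong)
  also have "\<dots> = chain_sum 1 (a # c) (\<lambda>_. 1) n + (\<Sum>j=1..n. ?g j / real j ^ a)"
    by (simp add: sum.distrib)
  also have "(\<Sum>j=1..n. ?g j / real j ^ a) = chain_sum 2 ((a # c) @ [x]) (chain_sum 1 ks (\<lambda>_. 1)) n"
    using 2 by (simp add: 1)
  finally show ?case .
qed

text \<open>A chain containing the index 1 ends in 1, where \<open>f\<close> vanishes.\<close>

lemma chain_sum_lower_2_eq_1:
  assumes "f 1 = 0" and "n \<ge> 1"
  shows "chain_sum 2 ks f n = chain_sum 1 ks f n"
  using assms(2)
proof (induction ks arbitrary: n)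
  case (Cons a ks)
  have 0: "chain_sum 2 ks f 1 = 0" using assms(1) by (cases ks) auto
  have "{1..n} = insert 1 {2..n}" using Cons.prems by auto
  then have "(\<Sum>j=1..n. chain_sum 2 ks f j / real j ^ a) = (\<Sum>j=2..n. chain_sum 2 ks f j / real j ^ a)"
    using 0 by simp
  moreover have "(\<Sum>j=1..n. chain_sum 2 ks f j / real j ^ a) = (\<Sum>j=1..n. chain_sum 1 ks f j / real j ^ a)"
    by (intro sum.cong) (auto simp: Cons.IH)
  ultimately show ?case by simp
qed simp

section \<open>Tails of a tuple, in particular tails of ones\<close>

text \<open>The weight \<open>real\<close> cancels one power of the last index. It bounds every tail
  and is the limit of tails of ones, so this identity leads from the digit \<open>Suc k\<close> to
  the digit \<open>k\<close>.\<close>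

lemma chain_sum_shift: "chain_sum 2 (c @ [Suc k]) real n = chain_sum 2 (c @ [k]) (\<lambda>_. 1) n"
proof -
  have "chain_sum 2 [Suc k] real j = chain_sum 2 [k] (\<lambda>_. 1) j" for j
    by (auto intro!: sum.cong)
  then have "chain_sum 2 [Suc k] real = chain_sum 2 [k] (\<lambda>_. 1)" by (rule ext)
  then show ?thesis by (simp only: chain_sum_append)
qed

lemma chain_sum_le_self:
  assumes "\<forall>k\<in>set ks. k \<ge> 1" and "n \<ge> 1"
  shows "chain_sum 1 ks (\<lambda>_. 1) n \<le> real n"
  using assms
proof (induction ks arbitrary: n)
  case (Cons k ks)
  have "chain_sum 1 (k # ks) (\<lambda>_. 1) n \<le> (\<Sum>j=1..n. 1)"
    unfolding chain_sum.simps
  proof (rule sum_mono)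
    fix j assume j: "j \<in> {1..n}"
    have "chain_sum 1 ks (\<lambda>_. 1) j \<le> real j ^ 1" using Cons j by simp
    also have "\<dots> \<le> real j ^ k" using j Cons.prems by (intro power_increasing) auto
    finally show "chain_sum 1 ks (\<lambda>_. 1) j / real j ^ k \<le> 1" using j by simp
  qed
  then show ?case by simp
qed simp

text \<open>Each further 1 shrinks the deficit from \<open>i\<close> by the factor
  \<open>1 - 1 / j\<close>: the summand at 1 is exact, and
  \<open>i - 1 \<le> i * (1 - 1 / j)\<close> since \<open>i \<le> j\<close>. Fixing \<open>j\<close>
  makes the factor uniform in \<open>i\<close> for the induction.\<close>

lemma chain_sum_ones_ge:
  assumes "1 \<le> i" and "i \<le> j"
  shows "chain_sum 1 (replicate t 1) (\<lambda>_. 1) i \<ge> real i * (1 - (1 - 1 / real j) ^ t)"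
  using assms
proof (induction t arbitrary: i)
  case (Suc t)
  define q where "q = 1 - 1 / real j"
  let ?h = "\<lambda>t. chain_sum 1 (replicate t 1) (\<lambda>_. 1)"
  have q: "q \<ge> 0" using Suc.prems by (simp add: q_def)
  have 1: "{1..i} = insert 1 {2..i}" using Suc.prems by auto
  have "(\<Sum>a=2..i. 1 - q ^ t) \<le> (\<Sum>a=2..i. ?h t a / real a)"
  proof (rule sum_mono)
    fix a assume a: "a \<in> {2..i}"
    then have "real a * (1 - q ^ t) \<le> ?h t a" using Suc by (simp add: q_def)
    then show "1 - q ^ t \<le> ?h t a / real a" using a by (simp add: field_simps)
  qed
  then have "?h (Suc t) i \<ge> 1 + (real i - 1) * (1 - q ^ t)"
    using Suc.prems by (simp add: 1 chain_sum_at_1 of_nat_diff)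
  moreover have "(real i - 1) * q ^ t \<le> (real i * q) * q ^ t"
    using q Suc.prems by (intro mult_right_mono) (auto simp: q_def field_simps)
  ultimately show ?case by (simp add: q_def algebra_simps)
qed simp

lemma chain_sum_ones_tendsto:
  assumes "j \<ge> 1"
  shows "(\<lambda>t. chain_sum 1 (replicate t 1) (\<lambda>_. 1) j) \<longlonglongrightarrow> real j"
proof (rule tendsto_sandwich)
  show "\<forall>\<^sub>F t in sequentially. real j * (1 - (1 - 1 / real j) ^ t) \<le> chain_sum 1 (replicate t 1) (\<lambda>_. 1) j"
    using chain_sum_ones_ge[of j j] assms by simp
  show "\<forall>\<^sub>F t in sequentially. chain_sum 1 (replicate t 1) (\<lambda>_. 1) j \<le> real j"
    using chain_sum_le_self[of "replicate _ 1" j] assms by simp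
  have "(\<lambda>t. (1 - 1 / real j) ^ t) \<longlonglongrightarrow> 0"
    by (rule LIMSEQ_realpow_zero) (use assms in \<open>auto simp: field_simps\<close>)
  then have "(\<lambda>t. real j * (1 - (1 - 1 / real j) ^ t)) \<longlonglongrightarrow> real j * (1 - 0)"
    by (intro tendsto_mult tendsto_diff tendsto_const)
  then show "(\<lambda>t. real j * (1 - (1 - 1 / real j) ^ t)) \<longlonglongrightarrow> real j" by simp
qed simp

section \<open>A bound independent of depth and truncation\<close>

text \<open>Summation by parts: the weight \<open>1 / (n (n - 1))\<close> absorbs one more factor \<open>1 / n\<close> for free.\<close>

lemma chain_sum_weighted_le_1:
  assumes "\<forall>k\<in>set ks. k \<ge> 1" and "N \<ge> 1"
  shows "(\<Sum>n=2..N. chain_sum 2 ks (\<lambda>_. 1) n / (real n * (real n - 1))) \<le> 1"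
  using assms
proof (induction ks)
  case Nil
  have "(\<Sum>n=2..N. 1 / (real n * (real n - 1))) = 1 - 1 / real N"
    using Nil(2)
  proof (induction N rule: dec_induct)
    case (step n)
    then have "(\<Sum>n=2..Suc n. 1 / (real n * (real n - 1))) = 1 - 1 / real n + 1 / (real (Suc n) * real n)"
      by simp
    also have "1 / (real (Suc n) * real n) = 1 / real n - 1 / real (Suc n)"
      using step(1) by (simp add: diff_frac_eq)
    finally show ?case by simp
  qed simp
  then show ?case by simp
next
  case (Cons k ks)
  let ?T = "\<lambda>ks. chain_sum 2 ks (\<lambda>_. 1)"
  let ?S = "\<lambda>ks N. \<Sum>n=2..N. ?T ks n / (real n * (real n - 1))"
  \<comment> \<open>The boundary term of the summation by parts makes the induction on
    \<open>N\<close> close; being nonnegative, it is dropped afterwards.\<close>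
  have "?S (k # ks) N + ?T (k # ks) N / real N \<le> ?S ks N"
    using Cons.prems(2)
  proof (induction N rule: dec_induct)
    case (step N)
    let ?t = "?T (k # ks) (Suc N)"
    have "x / ((a + 1) * a) + x / (a + 1) = x / a" if "a > 0" for x a :: real
    proof -
      have "1 / ((a + 1) * a) = 1 / a - 1 / (a + 1)"
        using that by (simp add: diff_frac_eq mult.commute)
      from arg_cong[OF this, of "\<lambda>z. x * z"] show ?thesis by (simp add: right_diff_distrib)
    qed
    from this[of "real N" ?t] have "?t / (real (Suc N) * real N) + ?t / real (Suc N) = ?t / real N"
      using step(1) by (simp only: of_nat_Suc add.commute)
    also have "?t / real N = ?T (k # ks) N / real N + ?T ks (Suc N) / real (Suc N) ^ k / real N"
      using step(1) by (simp add: add_divide_distrib)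
    also have "?T ks (Suc N) / real (Suc N) ^ k / real N \<le> ?T ks (Suc N) / real (Suc N) ^ 1 / real N"
      using step(1) Cons.prems(1)
      by (intro divide_right_mono divide_left_mono power_increasing chain_sum_nonneg) auto
    finally show ?case using step by simp
  qed simp
  moreover have "?T (k # ks) N / real N \<ge> 0"
    by (intro divide_nonneg_nonneg chain_sum_nonneg) auto
  ultimately show ?case using Cons by simp
qed

text \<open>The leading exponent is at least 2, so the outermost factor is at most
  \<open>1 / (n * (n - 1))\<close>. The bound yields both convergence and the bound 1 on all
  increments.\<close>

lemma chain_sum_admissible_le_1:
  assumes "admissible ks"
  shows "chain_sum 2 ks (\<lambda>_. 1) N \<le> 1"
proof (cases "N \<ge> 1")
  case True
  obtain k ls where ks: "ks = k # ls" using assms by (cases ks) (auto simp: admissible_def)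
  have k: "k \<ge> 2" "\<forall>k\<in>set ls. k \<ge> 1" using assms by (auto simp: admissible_def ks)
  have "chain_sum 2 ks (\<lambda>_. 1) N \<le> (\<Sum>n=2..N. chain_sum 2 ls (\<lambda>_. 1) n / (real n * (real n - 1)))"
    unfolding ks chain_sum.simps
  proof (intro sum_mono divide_left_mono chain_sum_nonneg)
    fix n assume n: "n \<in> {2..N}"
    have "real n * (real n - 1) \<le> real n ^ 2" by (simp add: power2_eq_square algebra_simps)
    also have "\<dots> \<le> real n ^ k" using n k by (intro power_increasing) auto
    finally show "real n * (real n - 1) \<le> real n ^ k" .
    show "0 < real n ^ k * (real n * (real n - 1))" using n by simp
  qed auto
  also have "\<dots> \<le> 1" by (rule chain_sum_weighted_le_1[OF k(2) True])
  finally show ?thesis .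
next
  case False
  then show ?thesis using assms by (cases ks) (auto simp: admissible_def)
qed

section \<open>From truncated sums to unordered infinite sums\<close>

lemma bounded_noninc_tuples_Suc:
  "{ns \<in> noninc_tuples m (Suc r). \<forall>n\<in>set ns. n \<le> N} =
    (\<Union>j\<in>{m..N}. (#) j ` {ns \<in> noninc_tuples m r. \<forall>n\<in>set ns. n \<le> j})"
  by (fastforce simp: noninc_tuples_def length_Suc_conv)

lemma finite_bounded_noninc_tuples: "finite {ns \<in> noninc_tuples m r. \<forall>n\<in>set ns. n \<le> N}"
  by (induction r arbitrary: N) (simp_all only: bounded_noninc_tuples_Suc, auto simp: noninc_tuples_def)

lemma chain_sum_eq_sum_tuples:
  "chain_sum m ks (\<lambda>_. 1) N =
    (\<Sum>ns | ns \<in> noninc_tuples m (length ks) \<and> (\<forall>n\<in>set ns. n \<le> N).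
      1 / (\<Prod>i<length ks. real (ns ! i) ^ (ks ! i)))"
proof (induction ks arbitrary: N)
  case Nil
  have "{ns \<in> noninc_tuples m 0. \<forall>n\<in>set ns. n \<le> N} = {[]}" by (auto simp: noninc_tuples_def)
  then show ?case by simp
next
  case (Cons k ks)
  let ?A = "\<lambda>r N. {ns \<in> noninc_tuples m r. \<forall>n\<in>set ns. n \<le> N}"
  let ?w = "\<lambda>ks ns. 1 / (\<Prod>i<length ks. real (ns ! i) ^ (ks ! i))"
  have "sum (?w (k # ks)) (?A (length (k # ks)) N) = (\<Sum>j=m..N. sum (?w (k # ks)) ((#) j ` ?A (length ks) j))"
    unfolding list.size add_0_right add_Suc_right bounded_noninc_tuples_Suc
    by (rule sum.UNION_disjoint) (auto simp: finite_bounded_noninc_tuples)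
  also have "\<dots> = (\<Sum>j=m..N. sum (?w ks) (?A (length ks) j) / real j ^ k)"
    by (intro sum.cong refl, subst sum.reindex)
       (auto simp: prod.lessThan_Suc_shift sum_divide_distrib simp del: prod.lessThan_Suc intro!: sum.cong)
  finally show ?case by (simp only: chain_sum.simps Cons.IH)
qed

text \<open>The terms are nonnegative and every finite set of tuples lies in a bounded one, so the
  truncations determine the unordered sum.\<close>

lemma star_sum_eqI:
  assumes "chain_sum m ks (\<lambda>_. 1) \<longlonglongrightarrow> L"
  shows "star_sum m ks = L"
proof -
  let ?A = "noninc_tuples m (length ks)"
  let ?w = "\<lambda>ns. 1 / (\<Prod>i<length ks. real (ns ! i) ^ (ks ! i))"
  let ?B = "\<lambda>N. {ns \<in> ?A. \<forall>n\<in>set ns. n \<le> N}"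
  have w: "?w ns \<ge> 0" for ns by (simp add: prod_nonneg)
  have le: "sum ?w F \<le> L" if F: "finite F" "F \<subseteq> ?A" for F
  proof -
    have "finite (\<Union>(set ` F))" using F by auto
    then obtain N where "\<forall>n\<in>\<Union>(set ` F). n \<le> N" using finite_nat_set_iff_bounded_le by blast
    then have "F \<subseteq> ?B N" using F by auto
    then have "sum ?w F \<le> sum ?w (?B N)"
      by (intro sum_mono2 finite_bounded_noninc_tuples w)
    also have "\<dots> \<le> L" unfolding chain_sum_eq_sum_tuples[symmetric]
      by (rule incseq_le[OF incseq_chain_sum_1 assms])
    finally show ?thesis .
  qed
  have "(?w has_sum L) ?A"
    unfolding has_sum_def
  proof (rule order_tendstoI)
    fix a assume "a < L"
    then obtain N where N: "a < chain_sum m ks (\<lambda>_. 1) N"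
      using order_tendstoD(1)[OF assms] eventually_happens' by force
    show "\<forall>\<^sub>F F in finite_subsets_at_top ?A. a < sum ?w F"
      unfolding eventually_finite_subsets_at_top
    proof (intro exI[of _ "?B N"] conjI allI impI)
      fix F assume F: "finite F \<and> ?B N \<subseteq> F \<and> F \<subseteq> ?A"
      then have "sum ?w (?B N) \<le> sum ?w F" by (intro sum_mono2 w) auto
      then show "a < sum ?w F" using N unfolding chain_sum_eq_sum_tuples by linarith
    qed (auto simp: finite_bounded_noninc_tuples)
  next
    fix a assume "L < a"
    then show "\<forall>\<^sub>F F in finite_subsets_at_top ?A. sum ?w F < a"
      unfolding eventually_finite_subsets_at_top using le by (intro exI[of _ "{}"]) force
  qed
  then show ?thesis unfolding star_sum_def by (rule infsumI)
qed

lemma star_sum_LIMSEQ: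
  assumes "\<And>N. chain_sum m ks (\<lambda>_. 1) N \<le> B"
  shows "chain_sum m ks (\<lambda>_. 1) \<longlonglongrightarrow> star_sum m ks"
proof -
  obtain L where "chain_sum m ks (\<lambda>_. 1) \<longlonglongrightarrow> L"
    using incseq_convergent[OF incseq_chain_sum_1] assms by metis
  then show ?thesis using star_sum_eqI by metis
qed

lemma admissible_append:
  assumes "ks \<noteq> []"
  shows "admissible (ks @ ls) \<longleftrightarrow> admissible ks \<and> (\<forall>k\<in>set ls. k \<ge> 1)"
  using assms by (auto simp: admissible_def)

lemma star_sum_2_LIMSEQ:
  assumes "admissible ks"
  shows "chain_sum 2 ks (\<lambda>_. 1) \<longlonglongrightarrow> star_sum 2 ks"
  by (rule star_sum_LIMSEQ, rule chain_sum_admissible_le_1[OF assms])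

text \<open>By \<open>chain_sum_split\<close> with an empty tail, every digit adds at most 1,
  starting from the value 1 of the empty tuple.\<close>

lemma chain_sum_1_bounded:
  assumes "ks = [] \<or> admissible ks"
  shows "chain_sum 1 ks (\<lambda>_. 1) N \<le> 1 + real (length ks)"
  using assms
proof (induction ks rule: rev_induct)
  case (snoc k ks)
  show ?case
  proof (cases "N \<ge> 1")
    case True
    have "ks = [] \<or> admissible ks" using snoc.prems admissible_append by blast
    then show ?thesis using chain_sum_split[OF True, of ks k "[]"] snoc
        chain_sum_admissible_le_1[of "ks @ [k]" N] by (simp add: chain_sum_append)
  next
    case False
    then show ?thesis by (cases ks) auto
  qed
qed simp

lemma zeta_star_LIMSEQ:
  assumes "ks = [] \<or> admissible ks"
  shows "chain_sum 1 ks (\<lambda>_. 1) \<longlonglongrightarrow> zeta_star ks"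
  unfolding zeta_star_def by (rule star_sum_LIMSEQ, rule chain_sum_1_bounded[OF assms])

lemma zeta_star_diff_LIMSEQ:
  assumes "admissible (c @ x # ks)"
  shows "chain_sum 2 (c @ [x]) (chain_sum 1 ks (\<lambda>_. 1)) \<longlonglongrightarrow> zeta_star (c @ x # ks) - zeta_star c"
proof (rule Lim_transform_eventually)
  have "c = [] \<or> admissible c" using assms admissible_append by blast
  then show "(\<lambda>n. chain_sum 1 (c @ x # ks) (\<lambda>_. 1) n - chain_sum 1 c (\<lambda>_. 1) n)
      \<longlonglongrightarrow> zeta_star (c @ x # ks) - zeta_star c"
    using assms by (intro tendsto_diff zeta_star_LIMSEQ) auto
  show "\<forall>\<^sub>F n in sequentially. chain_sum 1 (c @ x # ks) (\<lambda>_. 1) n - chain_sum 1 c (\<lambda>_. 1) n =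
      chain_sum 2 (c @ [x]) (chain_sum 1 ks (\<lambda>_. 1)) n"
    using eventually_ge_at_top[of 1] by eventually_elim (simp add: chain_sum_split)
qed

lemma zeta_star_snoc:
  assumes "admissible (c @ [x])"
  shows "zeta_star (c @ [x]) = zeta_star c + star_sum 2 (c @ [x])"
  using LIMSEQ_unique[OF star_sum_2_LIMSEQ[OF assms]] zeta_star_diff_LIMSEQ[OF assms]
  by (simp add: chain_sum_append fun_eq_iff)

lemma zeta_star_Nil: "zeta_star [] = 1"
  unfolding zeta_star_def by (rule star_sum_eqI) simp

lemma star_sum_2_pos:
  assumes "admissible ks"
  shows "star_sum 2 ks > 0"
proof -
  have "0 < chain_sum 2 ks (\<lambda>_. 1) 2" by (rule chain_sum_pos) auto
  also have "\<dots> \<le> star_sum 2 ks" by (rule incseq_le[OF incseq_chain_sum_1 star_sum_2_LIMSEQ[OF assms]])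
  finally show ?thesis .
qed

lemma star_sum_2_le_1:
  assumes "admissible ks"
  shows "star_sum 2 ks \<le> 1"
  using LIMSEQ_le_const2[OF star_sum_2_LIMSEQ[OF assms]] chain_sum_admissible_le_1[OF assms] by blast

section \<open>Lexicographic order of the values\<close>

lemma zeta_star_append_ge:
  assumes "admissible (c @ ks)"
  shows "zeta_star c \<le> zeta_star (c @ ks)"
  using assms
proof (induction ks rule: rev_induct)
  case (snoc k ks)
  show ?case
  proof (cases "c @ ks = []")
    case True
    then show ?thesis using zeta_star_snoc[of "[]" k] star_sum_2_pos snoc.prems by force
  next
    case False
    then have "admissible (c @ ks)" using snoc.prems admissible_append[of "c @ ks" "[k]"] by simp
    then show ?thesis using zeta_star_snoc[of "c @ ks" k] star_sum_2_pos[of "c @ ks @ [k]"] snoc by force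
  qed
qed simp

text \<open>Replacing the tail sum by its bound \<open>real\<close> turns the digit
  \<open>Suc k\<close> into \<open>k\<close>.\<close>

lemma zeta_star_append_Suc_less:
  assumes "admissible (c @ [k])" and "\<forall>k\<in>set ks. k \<ge> 1"
  shows "zeta_star (c @ Suc k # ks) < zeta_star (c @ [k])"
proof -
  have adm: "admissible (c @ Suc k # ls)" if "\<forall>k\<in>set ls. k \<ge> 1" for ls
    using assms(1) that by (cases c) (auto simp: admissible_def)
  have *: "zeta_star (c @ Suc k # ls) \<le> zeta_star (c @ [k])" if ls: "\<forall>k\<in>set ls. k \<ge> 1" for ls
  proof -
    have "zeta_star (c @ Suc k # ls) - zeta_star c \<le> star_sum 2 (c @ [k])"
    proof (rule LIMSEQ_le[OF zeta_star_diff_LIMSEQ[OF adm[OF ls]] star_sum_2_LIMSEQ[OF assms(1)]],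
           intro exI allI impI)
      fix n :: nat assume "2 \<le> n"
      then have "chain_sum 2 (c @ [Suc k]) (chain_sum 1 ls (\<lambda>_. 1)) n \<le> chain_sum 2 (c @ [Suc k]) real n"
        using chain_sum_le_self[OF ls] by (intro chain_sum_mono) auto
      then show "chain_sum 2 (c @ [Suc k]) (chain_sum 1 ls (\<lambda>_. 1)) n \<le> chain_sum 2 (c @ [k]) (\<lambda>_. 1) n"
        by (simp only: chain_sum_shift)
    qed
    then show ?thesis using zeta_star_snoc[OF assms(1)] by simp
  qed
  \<comment> \<open>Strictness: the weak bound also holds with one more 1 appended, which raises the
    value.\<close>
  have "zeta_star (c @ Suc k # ks) < zeta_star ((c @ Suc k # ks) @ [1])"
    using zeta_star_snoc[of "c @ Suc k # ks" 1] star_sum_2_pos adm[of "ks @ [1]"] assms(2) by auto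
  also have "\<dots> \<le> zeta_star (c @ [k])" using *[of "ks @ [1]"] assms(2) by auto
  finally show ?thesis .
qed

lemma zeta_star_last_antimono:
  assumes "admissible (c @ [k])" and "k \<le> k'"
  shows "zeta_star (c @ [k']) \<le> zeta_star (c @ [k])"
  using assms(2)
proof (induction k' rule: dec_induct)
  case (step n)
  have "admissible (c @ [n])" using assms(1) step(1) by (cases c) (auto simp: admissible_def)
  then show ?case using zeta_star_append_Suc_less[of c n "[]"] step.IH by simp
qed simp

lemma zeta_star_append_larger_less:
  assumes "admissible (c @ [x])" and "x < y" and "\<forall>k\<in>set ks. k \<ge> 1"
  shows "zeta_star (c @ y # ks) < zeta_star (c @ [x])"
proof -
  obtain z where z: "y = Suc z" "x \<le> z" using assms(2) by (cases y) auto
  have "admissible (c @ [z])" using assms(1) z by (cases c) (auto simp: admissible_def)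
  then show ?thesis using zeta_star_append_Suc_less[of c z ks] zeta_star_last_antimono[OF assms(1) z(2)] assms z
    by simp
qed

text \<open>At a fixed truncation the number of ones tends to infinity. Stated for truncated sums,
  it also covers \<open>c = []\<close>, \<open>k = 1\<close>, where the full sum diverges.\<close>

lemma chain_sum_le_of_ones_bounded:
  assumes "admissible (c @ [Suc k])" and "N \<ge> 2"
    and "\<And>t. zeta_star (c @ Suc k # replicate t 1) \<le> X"
  shows "chain_sum 2 (c @ [k]) (\<lambda>_. 1) N \<le> X - zeta_star c"
proof -
  have "(\<lambda>t. chain_sum 2 (c @ [Suc k]) (chain_sum 1 (replicate t 1) (\<lambda>_. 1)) N)
      \<longlonglongrightarrow> chain_sum 2 (c @ [Suc k]) real N"
    using assms(2) by (intro chain_sum_tendsto chain_sum_ones_tendsto) auto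
  moreover have "chain_sum 2 (c @ [Suc k]) (chain_sum 1 (replicate t 1) (\<lambda>_. 1)) N \<le> X - zeta_star c" for t
  proof -
    have "admissible (c @ Suc k # replicate t 1)"
      using assms(1) by (cases c) (auto simp: admissible_def)
    from incseq_le[OF incseq_chain_sum zeta_star_diff_LIMSEQ[OF this], of N] assms(3)[of t]
    show ?thesis by (force intro: chain_sum_nonneg)
  qed
  ultimately have "chain_sum 2 (c @ [Suc k]) real N \<le> X - zeta_star c"
    by (intro LIMSEQ_le_const2) auto
  then show ?thesis by (simp only: chain_sum_shift)
qed

section \<open>Monotone ratios and comparison with tuples of ones\<close>

text \<open>For positive \<open>v\<close>, this is monotonicity of the quotient \<open>u / v\<close>
  in division-free form.\<close>

definition mono_ratio :: "nat \<Rightarrow> (nat \<Rightarrow> real) \<Rightarrow> (nat \<Rightarrow> real) \<Rightarrow> bool" where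
  "mono_ratio m u v \<longleftrightarrow> (\<forall>x\<ge>m. \<forall>y\<ge>x. u x * v y \<le> u y * v x)"

text \<open>The products of the parts up to \<open>x\<close> cancel; what remains compares indices
  up to \<open>x\<close> with indices beyond it, pair by pair.\<close>

lemma mono_ratio_sum:
  assumes "mono_ratio m u v"
  shows "mono_ratio m (\<lambda>n. \<Sum>j=m..n. u j) (\<lambda>n. \<Sum>j=m..n. v j)"
  unfolding mono_ratio_def
proof (intro allI impI)
  fix x y assume xy: "m \<le> x" "x \<le> y"
  have split: "sum f {m..y} = sum f {m..x} + sum f {x<..y}" for f :: "nat \<Rightarrow> real"
  proof -
    have "{m..y} = {m..x} \<union> {x<..y}" using xy by auto
    then show ?thesis by (simp only:) (rule sum.union_disjoint, auto)
  qed
  have "sum u {m..x} * sum v {x<..y} \<le> sum v {m..x} * sum u {x<..y}"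
    unfolding sum_product
    by (intro sum_mono) (use assms in \<open>auto simp: mono_ratio_def mult.commute\<close>)
  then show "sum u {m..x} * sum v {m..y} \<le> sum u {m..y} * sum v {m..x}"
    by (simp add: split algebra_simps)
qed

lemma mono_ratio_divide_power:
  assumes "mono_ratio m u v" and "m \<ge> 1" and "k' \<le> k"
    and "\<And>j. j \<ge> m \<Longrightarrow> u j \<ge> 0" and "\<And>j. j \<ge> m \<Longrightarrow> v j \<ge> 0"
  shows "mono_ratio m (\<lambda>j. u j / real j ^ k') (\<lambda>j. v j / real j ^ k)"
  unfolding mono_ratio_def
proof (intro allI impI)
  fix x y assume xy: "m \<le> x" "x \<le> y"
  obtain d where d: "k = k' + d" using assms(3) le_Suc_ex by blast
  have "real y ^ k' * real x ^ k \<le> real x ^ k' * real y ^ k"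
    using xy by (simp add: d power_add mult.left_commute mult_left_mono power_mono)
  then have "(u x * v y) / (real x ^ k' * real y ^ k) \<le> (u y * v x) / (real y ^ k' * real x ^ k)"
    using xy assms by (intro frac_le) (auto simp: mono_ratio_def)
  then show "u x / real x ^ k' * (v y / real y ^ k) \<le> u y / real y ^ k' * (v x / real x ^ k)"
    by simp
qed

text \<open>
  A Chebyshev-type inequality: the mean of \<open>u / v\<close> with respect to the weight \<open>v\<close> is at most
  the mean of the larger, increasing ratio \<open>u' / v'\<close> with respect to \<open>v'\<close>, since \<open>v'\<close> puts
  relatively more mass on large arguments.
\<close>

lemma sum_ratio_le:
  fixes u v u' v' :: "nat \<Rightarrow> real"
  assumes "mono_ratio m u' v'" and "mono_ratio m v' v"
    and le: "\<And>j. j \<ge> m \<Longrightarrow> u j * v' j \<le> u' j * v j"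
    and pos: "\<And>j. j \<ge> m \<Longrightarrow> v j > 0" "\<And>j. j \<ge> m \<Longrightarrow> v' j > 0"
  shows "sum u {m..n} * sum v' {m..n} \<le> sum u' {m..n} * sum v {m..n}"
proof -
  \<comment> \<open>Summed over all pairs, \<open>?d\<close> gives twice the difference of the two
    sides. It is symmetric, so nonnegativity for \<open>x \<le> y\<close> suffices.\<close>
  let ?d = "\<lambda>x y. v x * u' y + v y * u' x - u x * v' y - u y * v' x"
  have ordered: "?d x y \<ge> 0" if xy: "m \<le> x" "x \<le> y" for x y
  proof -
    define r where "r = (\<lambda>j. u' j / v' j)"
    have u': "u' j = r j * v' j" if "j \<ge> m" for j using pos(2)[OF that] by (simp add: r_def)
    have u: "u j \<le> r j * v j" if "j \<ge> m" for j
      using le[OF that] pos(2)[OF that] by (simp add: r_def field_simps)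
    have "r x \<le> r y"
      using assms(1) xy pos(2)[of x] pos(2)[of y] by (simp add: mono_ratio_def r_def field_simps)
    moreover have "v' x * v y \<le> v' y * v x" using assms(2) xy by (simp add: mono_ratio_def)
    \<comment> \<open>After bounding \<open>u\<close> by \<open>r * v\<close> and writing
      \<open>u'\<close> as \<open>r * v'\<close>, \<open>?d x y\<close> is at least this
      product.\<close>
    ultimately have "0 \<le> (r y - r x) * (v' y * v x - v' x * v y)" by simp
    moreover have "u x * v' y \<le> r x * v x * v' y"
      using u xy pos(2)[of y] by (intro mult_right_mono) auto
    moreover have "u y * v' x \<le> r y * v y * v' x"
      using u xy pos(2)[of x] by (intro mult_right_mono) auto
    moreover have "u' x = r x * v' x" "u' y = r y * v' y" using u' xy by auto
    ultimately show ?thesis by (simp add: algebra_simps)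
  qed
  have "?d x y \<ge> 0" if "m \<le> x" "m \<le> y" for x y
    using ordered[of x y] ordered[of y x] that by (cases "x \<le> y") auto
  then have "0 \<le> (\<Sum>x=m..n. \<Sum>y=m..n. ?d x y)" by (intro sum_nonneg) auto
  also have "\<dots> = 2 * (sum u' {m..n} * sum v {m..n} - sum u {m..n} * sum v' {m..n})"
    by (simp add: sum_subtractf sum.distrib flip: sum_distrib_left sum_distrib_right)
  finally show ?thesis by simp
qed

text \<open>The three claims are carried together because \<open>sum_ratio_le\<close> needs both
  monotone ratios at every level.\<close>

lemma chain_sum_ratio_le:
  assumes "list_all2 (\<ge>) ks ls" and m: "m \<ge> 1"
    and base: "mono_ratio m u' v'" "mono_ratio m v' v" "\<And>j. j \<ge> m \<Longrightarrow> u j * v' j \<le> u' j * v j"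
    and pos: "\<And>j. j \<ge> m \<Longrightarrow> v j > 0" "\<And>j. j \<ge> m \<Longrightarrow> v' j > 0"
    and nonneg: "\<And>j. u' j \<ge> 0"
  shows "mono_ratio m (chain_sum m ls u') (chain_sum m ls v') \<and>
    mono_ratio m (chain_sum m ls v') (chain_sum m ks v) \<and>
    (\<forall>j\<ge>m. chain_sum m ks u j * chain_sum m ls v' j \<le> chain_sum m ls u' j * chain_sum m ks v j)"
  using assms(1)
proof (induction rule: list_all2_induct)
  case Nil
  then show ?case using base by simp
next
  case (Cons k ks k' ls)
  let ?w = "\<lambda>k ks f j. chain_sum m ks f j / real j ^ k"
  have cs: "chain_sum m (k # ks) f = (\<lambda>n. sum (?w k ks f) {m..n})" for k ks f
    by (simp add: fun_eq_iff)
  have v_pos: "chain_sum m ks v j > 0" "chain_sum m ls v' j > 0" if "j \<ge> m" for j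
    using chain_sum_pos[OF m] pos that by auto
  have u'_nonneg: "chain_sum m ls u' j \<ge> 0" for j by (intro chain_sum_nonneg nonneg)
  have 1: "mono_ratio m (?w k' ls u') (?w k' ls v')"
    using Cons m v_pos u'_nonneg by (intro mono_ratio_divide_power) (auto simp: less_imp_le)
  have 2: "mono_ratio m (?w k' ls v') (?w k ks v)"
    using Cons m v_pos by (intro mono_ratio_divide_power) (auto simp: less_imp_le)
  have 3: "sum (?w k ks u) {m..n} * sum (?w k' ls v') {m..n} \<le> sum (?w k' ls u') {m..n} * sum (?w k ks v) {m..n}" for n
  proof (rule sum_ratio_le[OF 1 2])
    fix j assume j: "j \<ge> m"
    have "chain_sum m ks u j * chain_sum m ls v' j / (real j ^ k * real j ^ k')
        \<le> chain_sum m ls u' j * chain_sum m ks v j / (real j ^ k * real j ^ k')"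
      using Cons j by (intro divide_right_mono) auto
    then show "?w k ks u j * ?w k' ls v' j \<le> ?w k' ls u' j * ?w k ks v j"
      by (simp add: mult.commute)
  qed (use v_pos m in auto)
  show ?case unfolding cs using mono_ratio_sum[OF 1] mono_ratio_sum[OF 2] 3 by simp
qed

text \<open>Cross-multiplied form of: among extensions of \<open>c\<close> of a given length, the
  tuple of ones maximizes the ratio of the next increment to the growth since
  \<open>c\<close>.\<close>

lemma star_sum_ratio_le_ones:
  assumes "admissible (c @ x # ks)" and "c \<noteq> []"
  shows "star_sum 2 (c @ x # ks @ [1]) * (zeta_star (c @ 1 # replicate (length ks) 1) - zeta_star c)
    \<le> star_sum 2 (c @ 1 # replicate (length ks) 1 @ [1]) * (zeta_star (c @ x # ks) - zeta_star c)"
proof -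
  define os :: "nat list" where "os = replicate (length ks) 1"
  \<comment> \<open>The appended digit 1, seen as an innermost weight. It is increasing, as the
    comparison requires, and vanishes at 1, so that the lower bounds 1 and 2 agree on the
    tail.\<close>
  define \<phi> where "\<phi> = chain_sum 2 [1] (\<lambda>_. 1)"
  have c: "admissible c" and xks: "x \<ge> 1" "\<forall>k\<in>set ks. k \<ge> 1"
    using assms admissible_append by auto
  have adm_os: "admissible (c @ 1 # os)"
    using c assms(2) by (auto simp: admissible_append os_def)
  have \<phi>_nonneg: "\<phi> j \<ge> 0" for j unfolding \<phi>_def by (intro chain_sum_nonneg) auto
  have \<phi>_1: "\<phi> 1 = 0" by (simp add: \<phi>_def)
  have "incseq \<phi>" unfolding \<phi>_def by (rule incseq_chain_sum_1)
  have all2: "list_all2 (\<ge>) ks os"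
    using xks by (auto simp: os_def list_all2_conv_all_nth)
  let ?C1 = "\<lambda>ks f. chain_sum 1 ks f"
  have I: "mono_ratio 1 (?C1 os \<phi>) (?C1 os (\<lambda>_. 1)) \<and> mono_ratio 1 (?C1 os (\<lambda>_. 1)) (?C1 ks (\<lambda>_. 1)) \<and>
      (\<forall>j\<ge>1. ?C1 ks \<phi> j * ?C1 os (\<lambda>_. 1) j \<le> ?C1 os \<phi> j * ?C1 ks (\<lambda>_. 1) j)"
    using \<open>incseq \<phi>\<close> \<phi>_nonneg
    by (intro chain_sum_ratio_le all2) (auto simp: mono_ratio_def incseq_def)
  have all2': "list_all2 (\<ge>) (c @ [x]) (c @ [1])"
    using xks by (intro list_all2_appendI) (auto simp: list_all2_conv_all_nth)
  \<comment> \<open>The comparison \<open>I\<close> of the tails serves as base for a second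
    application, now to \<open>c\<close> and the first new digit, with lower bound 2.\<close>
  have II: "\<forall>j\<ge>2. chain_sum 2 (c @ [x]) (?C1 ks \<phi>) j * chain_sum 2 (c @ [1]) (?C1 os (\<lambda>_. 1)) j
      \<le> chain_sum 2 (c @ [1]) (?C1 os \<phi>) j * chain_sum 2 (c @ [x]) (?C1 ks (\<lambda>_. 1)) j"
  proof (intro chain_sum_ratio_le[OF all2', THEN conjunct2, THEN conjunct2])
    show "mono_ratio 2 (?C1 os \<phi>) (?C1 os (\<lambda>_. 1))" "mono_ratio 2 (?C1 os (\<lambda>_. 1)) (?C1 ks (\<lambda>_. 1))"
      using I by (auto simp: mono_ratio_def)
    show "?C1 ks \<phi> j * ?C1 os (\<lambda>_. 1) j \<le> ?C1 os \<phi> j * ?C1 ks (\<lambda>_. 1) j" if "j \<ge> 2" for j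
      using I that by auto
  qed (auto intro!: chain_sum_pos chain_sum_nonneg \<phi>_nonneg)
  have lim: "chain_sum 2 (c @ [y]) (?C1 zs \<phi>) \<longlonglongrightarrow> star_sum 2 (c @ y # zs @ [1])"
    if "admissible (c @ y # zs)" for y zs
  proof (rule Lim_transform_eventually)
    have "admissible (c @ y # zs @ [1])"
      using that assms(2) by (auto simp: admissible_append)
    then show "chain_sum 2 (c @ y # zs @ [1]) (\<lambda>_. 1) \<longlonglongrightarrow> star_sum 2 (c @ y # zs @ [1])"
      by (rule star_sum_2_LIMSEQ)
    have "chain_sum 2 (c @ y # zs @ [1]) (\<lambda>_. 1) n = chain_sum 2 (c @ [y]) (?C1 zs \<phi>) n" if "n \<ge> 2" for n
    proof -
      have "chain_sum 2 (c @ y # zs @ [1]) (\<lambda>_. 1) n = chain_sum 2 ((c @ [y]) @ zs @ [1]) (\<lambda>_. 1) n"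
        by simp
      also have "\<dots> = chain_sum 2 (c @ [y]) (chain_sum 2 (zs @ [1]) (\<lambda>_. 1)) n"
        by (rule chain_sum_append)
      also have "\<dots> = chain_sum 2 (c @ [y]) (?C1 zs \<phi>) n"
        using that \<phi>_1
        by (intro chain_sum_cong) (auto simp: chain_sum_append chain_sum_lower_2_eq_1 simp flip: \<phi>_def)
      finally show ?thesis .
    qed
    then show "\<forall>\<^sub>F n in sequentially. chain_sum 2 (c @ y # zs @ [1]) (\<lambda>_. 1) n = chain_sum 2 (c @ [y]) (?C1 zs \<phi>) n"
      unfolding eventually_sequentially by blast
  qed
  show ?thesis unfolding os_def[symmetric]
    by (rule LIMSEQ_le[OF tendsto_mult[OF lim[OF assms(1)] zeta_star_diff_LIMSEQ[OF adm_os]]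
          tendsto_mult[OF lim[OF adm_os] zeta_star_diff_LIMSEQ[OF assms(1)]]]) (use II in auto)
qed

section \<open>Increments are eventually dominated by the growth\<close>

text \<open>The growth is the partial sum of the increments \<open>b\<close>. If \<open>b\<close> is
  summable, its terms fall below \<open>b 0\<close>, which the sum contains once
  \<open>t \<ge> 1\<close>; otherwise the sum exceeds 1, which bounds every increment.\<close>

lemma star_sum_ones_eventually_le:
  assumes "admissible c"
  shows "\<exists>T\<ge>1. \<forall>t\<ge>T. star_sum 2 (c @ replicate t 1 @ [1]) \<le> zeta_star (c @ replicate t 1) - zeta_star c"
proof -
  define b where "b t = star_sum 2 (c @ replicate t 1 @ [1])" for t
  have adm: "admissible (c @ replicate t 1 @ [1])" for t
    using assms by (subst admissible_append) (auto simp: admissible_def)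
  have b: "b t > 0" "b t \<le> 1" for t
    using star_sum_2_pos[OF adm] star_sum_2_le_1[OF adm] by (auto simp: b_def)
  have zeta: "zeta_star (c @ replicate t 1) - zeta_star c = (\<Sum>i<t. b i)" for t
  proof (induction t)
    case (Suc t)
    then show ?case using zeta_star_snoc[of "c @ replicate t 1" 1] adm[of t]
      by (simp add: b_def replicate_append_same)
  qed simp
  have mono: "(\<Sum>i<s. b i) \<le> (\<Sum>i<t. b i)" if "s \<le> t" for s t
    using that b by (intro sum_mono2) (auto simp: less_imp_le)
  have "\<exists>T\<ge>1. \<forall>t\<ge>T. b t \<le> (\<Sum>i<t. b i)"
  proof (cases "summable b")
    case True
    then have "\<forall>\<^sub>F t in sequentially. b t < b 0" using summable_LIMSEQ_zero order_tendstoD(2) b by blast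
    then obtain T where T: "\<And>t. t \<ge> T \<Longrightarrow> b t < b 0" by (auto simp: eventually_sequentially)
    show ?thesis
    proof (intro exI[of _ "max 1 T"] conjI allI impI)
      fix t assume "max 1 T \<le> t"
      then show "b t \<le> (\<Sum>i<t. b i)" using T[of t] mono[of 1 t] by (simp add: One_nat_def)
    qed simp
  next
    case False
    then obtain T where T: "(\<Sum>i<T. b i) > 1"
      using summableI_nonneg_bounded[of b 1] b by (meson less_imp_le not_le)
    show ?thesis
    proof (intro exI[of _ "max 1 T"] conjI allI impI)
      fix t assume "max 1 T \<le> t"
      then show "b t \<le> (\<Sum>i<t. b i)" using T mono[of T t] b(2)[of t] by simp
    qed simp
  qed
  then show ?thesis by (simp add: zeta b_def)
qed

lemma star_sum_eventually_le:
  assumes "admissible c"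
  shows "\<exists>T. \<forall>ks. length ks \<ge> T \<longrightarrow> (\<forall>k\<in>set ks. k \<ge> 1) \<longrightarrow>
    star_sum 2 (c @ ks @ [1]) \<le> zeta_star (c @ ks) - zeta_star c"
proof -
  obtain T where T: "T \<ge> 1" "\<And>t. t \<ge> T \<Longrightarrow>
      star_sum 2 (c @ replicate t 1 @ [1]) \<le> zeta_star (c @ replicate t 1) - zeta_star c"
    using star_sum_ones_eventually_le[OF assms] by blast
  have "star_sum 2 (c @ ks @ [1]) \<le> zeta_star (c @ ks) - zeta_star c"
    if len: "length ks \<ge> T" and ks: "\<forall>k\<in>set ks. k \<ge> 1" for ks
  proof -
    obtain x ls where xls: "ks = x # ls" using len T(1) by (cases ks) auto
    let ?B = "star_sum 2 (c @ replicate (length ks) 1 @ [1])"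
    let ?A = "zeta_star (c @ replicate (length ks) 1) - zeta_star c"
    let ?a = "zeta_star (c @ ks) - zeta_star c"
    have c: "c \<noteq> []" using assms by (auto simp: admissible_def)
    have adm: "admissible (c @ ks)" using assms ks c by (simp add: admissible_append)
    have "star_sum 2 (c @ ks @ [1]) * ?A \<le> ?B * ?a"
      using star_sum_ratio_le_ones[of c x ls] adm c by (simp add: xls)
    also have "\<dots> \<le> ?A * ?a"
      using T(2)[OF len] zeta_star_append_ge[OF adm] by (intro mult_right_mono) auto
    finally have "star_sum 2 (c @ ks @ [1]) * ?A \<le> ?a * ?A" by (simp add: mult.commute)
    \<comment> \<open>Together with \<open>?B \<le> ?A\<close> this makes \<open>?A\<close>
      positive, so it can be cancelled.\<close>
    moreover have "?B > 0"
      using assms c by (intro star_sum_2_pos) (simp add: admissible_append)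
    ultimately show ?thesis using T(2)[OF len] by simp
  qed
  then show ?thesis by blast
qed

section \<open>Approximations of a zeta-star value\<close>

lemma zeta_star_approximations_bounded_length:
  assumes l: "admissible l"
  shows "\<exists>R. \<forall>ks. admissible ks \<longrightarrow> length ks \<ge> R \<longrightarrow> star_sum 2 (ks @ [1]) \<le> \<bar>zeta_star l - zeta_star ks\<bar>"
proof -
  \<comment> \<open>Besides \<open>l\<close>, these are the proper prefixes of \<open>l\<close>
    followed by a digit smaller than the one in \<open>l\<close>. A long \<open>ks\<close> either
    extends a member of \<open>C\<close> or has a larger digit at its first difference from
    \<open>l\<close>.\<close>
  define C where "C = insert l ((\<lambda>(p, y). take p l @ [y]) ` (SIGMA p:{..<length l}. {..<l ! p}))"
  have "finite C" by (simp add: C_def)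
  \<comment> \<open>Members of \<open>C\<close> ending in 0 are inadmissible, hence the premise on
    \<open>c\<close>.\<close>
  have "\<forall>c\<in>C. \<exists>T. admissible c \<longrightarrow> (\<forall>ks. length ks \<ge> T \<longrightarrow> (\<forall>k\<in>set ks. k \<ge> 1) \<longrightarrow>
    star_sum 2 (c @ ks @ [1]) \<le> zeta_star (c @ ks) - zeta_star c)"
    using star_sum_eventually_le by blast
  then obtain T where T: "\<And>c ks. c \<in> C \<Longrightarrow> admissible c \<Longrightarrow> length ks \<ge> T c \<Longrightarrow> \<forall>k\<in>set ks. k \<ge> 1 \<Longrightarrow>
    star_sum 2 (c @ ks @ [1]) \<le> zeta_star (c @ ks) - zeta_star c"
    by (metis bchoice)
  have above: "star_sum 2 ((c @ ks) @ [1]) \<le> \<bar>zeta_star l - zeta_star (c @ ks)\<bar>"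
    if "c \<in> C" "admissible (c @ ks)" "c \<noteq> []" "length ks \<ge> sum T C" "zeta_star l \<le> zeta_star c" for c ks
  proof -
    have "T c \<le> sum T C" using \<open>finite C\<close> that(1) by (intro member_le_sum) auto
    then have "star_sum 2 (c @ ks @ [1]) \<le> zeta_star (c @ ks) - zeta_star c"
      using that admissible_append[of c ks] by (intro T) auto
    then show ?thesis using that(5) by simp
  qed
  \<comment> \<open>Members of \<open>C\<close> have length at most \<open>length l\<close>, so at
    least \<open>sum T C\<close> digits remain after one; the extra 1 excludes that
    \<open>ks\<close> is a prefix of \<open>l\<close>.\<close>
  have "star_sum 2 (ks @ [1]) \<le> \<bar>zeta_star l - zeta_star ks\<bar>"
    if ks: "admissible ks" and len: "length ks \<ge> length l + 1 + sum T C" for ks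
  proof -
    consider "prefix l ks" | "prefix ks l" | "l \<parallel> ks" by blast
    then show ?thesis
    proof cases
      case 1
      then obtain m where "ks = l @ m" by (auto simp: prefix_def)
      then show ?thesis using above[of l m] ks l len by (auto simp: C_def admissible_def)
    next
      case 2
      then show ?thesis using len prefix_length_le by fastforce
    next
      case 3
      then obtain c x y l' k' where xy: "x \<noteq> y" and lc: "l = c @ x # l'" and kc: "ks = c @ y # k'"
        using parallel_decomp by blast
      have adm_x: "admissible (c @ [x])" and l': "\<forall>k\<in>set l'. k \<ge> 1"
        using l admissible_append[of "c @ [x]" l'] by (auto simp: lc)
      have adm_y: "admissible (c @ [y])" and k': "\<forall>k\<in>set k'. k \<ge> 1"
        using ks admissible_append[of "c @ [y]" k'] by (auto simp: kc)
      show ?thesis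
      proof (cases "y < x")
        case True
        have "zeta_star l < zeta_star (c @ [y])"
          unfolding lc by (rule zeta_star_append_larger_less[OF adm_y True l'])
        moreover have "c @ [y] \<in> C"
          unfolding C_def using True
          by (intro insertI2 image_eqI[of _ _ "(length c, y)"]) (auto simp: lc)
        moreover have "length k' \<ge> sum T C" using len by (simp add: lc kc)
        ultimately show ?thesis using above[of "c @ [y]" k'] ks by (simp add: kc)
      next
        case False
        \<comment> \<open>A larger digit keeps the value below that of \<open>l\<close> even after
          appending a 1, so the increment is smaller than the gap.\<close>
        then have "zeta_star (c @ y # (k' @ [1])) < zeta_star (c @ [x])"
          using xy k' by (intro zeta_star_append_larger_less[OF adm_x]) auto
        also have "\<dots> \<le> zeta_star l"
          using zeta_star_append_ge[of "c @ [x]" l'] l by (simp add: lc)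
        finally have "zeta_star (ks @ [1]) < zeta_star l" by (simp add: kc)
        moreover have "admissible (ks @ [1])"
          using ks by (subst admissible_append) (auto simp: admissible_def)
        ultimately show ?thesis using zeta_star_snoc[of ks 1] by simp
      qed
    qed
  qed
  then show ?thesis by blast
qed

section \<open>Greedy expansion of a number that is not a value\<close>

lemma star_sum_last_geometric:
  assumes "admissible (d @ [k])"
  shows "star_sum 2 (d @ [k + i]) \<le> (1 / 2) ^ i"
proof -
  have adm: "admissible (d @ [k + i])" using assms by (cases d) (auto simp: admissible_def)
  have "chain_sum 2 (d @ [k + i]) (\<lambda>_. 1) N \<le> (1 / 2) ^ i" if "N \<ge> 2" for N
  proof -
    have "chain_sum 2 [k + i] (\<lambda>_. 1) j \<le> (1 / 2) ^ i * chain_sum 2 [k] (\<lambda>_. 1) j" for j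
      unfolding chain_sum.simps sum_distrib_left
    proof (rule sum_mono)
      fix a assume "a \<in> {2..j}"
      then have "(2 :: real) ^ i \<le> real a ^ i" "real a ^ k > 0" by (auto intro!: power_mono)
      then show "1 / real a ^ (k + i) \<le> (1 / 2) ^ i * (1 / real a ^ k)"
        using \<open>a \<in> {2..j}\<close> by (simp add: power_add power_one_over divide_simps)
    qed
    then have "chain_sum 2 (d @ [k + i]) (\<lambda>_. 1) N \<le> chain_sum 2 d (\<lambda>j. (1 / 2) ^ i * chain_sum 2 [k] (\<lambda>_. 1) j) N"
      unfolding chain_sum_append using that by (intro chain_sum_mono)
    also have "\<dots> = (1 / 2) ^ i * chain_sum 2 (d @ [k]) (\<lambda>_. 1) N"
      by (simp only: chain_sum_scale chain_sum_append)
    also have "\<dots> \<le> (1 / 2) ^ i * 1"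
      by (intro mult_left_mono chain_sum_admissible_le_1 assms) auto
    finally show ?thesis by simp
  qed
  then show ?thesis by (intro LIMSEQ_le_const2[OF star_sum_2_LIMSEQ[OF adm]]) blast
qed

text \<open>Only the last digit is constrained to be a greedy choice. The admissibility guard
  exempts \<open>[2]\<close>, whose predecessor \<open>[1]\<close> belongs to a divergent
  series.\<close>

definition greedy :: "real \<Rightarrow> nat list \<Rightarrow> bool" where
  "greedy \<alpha> ks \<longleftrightarrow> (\<exists>c k. ks = c @ [Suc k] \<and> k \<ge> 1 \<and> admissible ks \<and> zeta_star ks < \<alpha> \<and>
     (admissible (c @ [k]) \<longrightarrow> \<alpha> \<le> zeta_star (c @ [k])))"

text \<open>The least digit keeping the value below \<alpha> works. One exists because large digits
  add less than the gap \<open>\<alpha> - zeta_star d\<close>, and the last assumption rules out the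
  digit 1.\<close>

lemma greedy_next_digit:
  assumes "admissible (d @ [k0])" and "zeta_star d < \<alpha>"
    and "d \<noteq> [] \<Longrightarrow> \<alpha> \<le> zeta_star (d @ [1])"
  shows "\<exists>k. greedy \<alpha> (d @ [k])"
proof -
  let ?P = "\<lambda>k. admissible (d @ [k]) \<and> zeta_star (d @ [k]) < \<alpha>"
  obtain i where i: "(1 / 2 :: real) ^ i < \<alpha> - zeta_star d"
    using real_arch_pow_inv[of "\<alpha> - zeta_star d" "1 / 2"] assms(2) by auto
  have "admissible (d @ [k0 + i])" using assms(1) by (cases d) (auto simp: admissible_def)
  then have "?P (k0 + i)"
    using i star_sum_last_geometric[OF assms(1), of i] zeta_star_snoc[of d "k0 + i"] by simp
  then have "?P (LEAST k. ?P k)" by (rule LeastI)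
  moreover define K where "K = (LEAST k. ?P k)"
  ultimately have K: "?P K" by simp
  have "K \<noteq> 0" using K by (auto simp: admissible_def)
  moreover have "K \<noteq> 1" using K assms(3) by (cases "d = []") (auto simp: admissible_def)
  ultimately obtain k where k: "K = Suc k" "k \<ge> 1" by (cases K) auto
  have "\<not> ?P k" using not_less_Least[of k ?P] k by (simp add: K_def)
  then have "greedy \<alpha> (d @ [Suc k])" unfolding greedy_def using K k by auto
  then show ?thesis by blast
qed

lemma chain_sum_harmonic_unbounded: "\<exists>N\<ge>2. chain_sum 2 [1] (\<lambda>_. 1) N > X"
proof (rule ccontr)
  assume *: "\<not> ?thesis"
  have "summable (\<lambda>n. 1 / real (n + 2))"
  proof (rule summableI_nonneg_bounded)
    fix n
    have "(\<Sum>i<n. 1 / real (i + 2)) = (\<Sum>j=2..<n+2. 1 / real j)"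
      by (rule sum.reindex_bij_witness[of _ "\<lambda>j. j - 2" "\<lambda>i. i + 2"]) auto
    also have "\<dots> \<le> (\<Sum>j=2..n+2. 1 / real j)" by (intro sum_mono2) auto
    also have "\<dots> \<le> X" using *[simplified, rule_format, of "n + 2"] by simp
    finally show "(\<Sum>i<n. 1 / real (i + 2)) \<le> X" .
  qed simp
  then have "summable (\<lambda>n. 1 / real n)" by (subst (asm) summable_iff_shift)
  then show False using not_summable_harmonic[where 'a = real] by (simp add: inverse_eq_divide)
qed

text \<open>Appended ones drive the value up to that of \<open>c @ [k]\<close>, which is at least
  \<alpha>. Never reaching \<alpha> would make \<alpha> equal to that value or, for
  \<open>[2]\<close>, bound the harmonic sums.\<close>

lemma greedy_ones_reach:
  assumes "greedy \<alpha> ks" and "\<alpha> \<notin> zeta_star_values"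
  shows "\<exists>t. \<alpha> \<le> zeta_star (ks @ replicate t 1)"
proof (rule ccontr)
  assume unreached: "\<nexists>t. \<alpha> \<le> zeta_star (ks @ replicate t 1)"
  obtain c k where ck: "ks = c @ [Suc k]" "k \<ge> 1" "admissible (c @ [Suc k])"
      "admissible (c @ [k]) \<Longrightarrow> \<alpha> \<le> zeta_star (c @ [k])"
    using assms(1) by (auto simp: greedy_def)
  have "zeta_star (c @ Suc k # replicate t 1) \<le> \<alpha>" for t
    using unreached by (simp add: ck(1) not_le less_imp_le)
  then have le: "chain_sum 2 (c @ [k]) (\<lambda>_. 1) N \<le> \<alpha> - zeta_star c" if "N \<ge> 2" for N
    using that by (intro chain_sum_le_of_ones_bounded ck(3))
  show False
  proof (cases "admissible (c @ [k])")
    case True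
    then have "star_sum 2 (c @ [k]) \<le> \<alpha> - zeta_star c"
      using le by (intro LIMSEQ_le_const2[OF star_sum_2_LIMSEQ]) auto
    then have "\<alpha> = zeta_star (c @ [k])" using zeta_star_snoc[OF True] ck(4)[OF True] by simp
    then show False using assms(2) True by (auto simp: zeta_star_values_def)
  next
    case False
    then have "c = []" "k = 1" using ck(2,3) by (cases c; auto simp: admissible_def)+
    then show False using le chain_sum_harmonic_unbounded[of "\<alpha> - zeta_star c"] by force
  qed
qed

text \<open>Append ones and stop just before \<alpha> is reached: this is \<open>d\<close>, and its
  next greedy digit exceeds 1. Both inequalities are strict since \<alpha> is not a value.\<close>

lemma greedy_extend:
  assumes "greedy \<alpha> ks" and "\<alpha> \<notin> zeta_star_values"
  shows "\<exists>d k. admissible d \<and> length d \<ge> length ks \<and> zeta_star d < \<alpha> \<and> \<alpha> < zeta_star (d @ [1]) \<and> greedy \<alpha> (d @ [k])"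
proof -
  have ks: "admissible ks" "ks \<noteq> []" "zeta_star ks < \<alpha>"
    using assms(1) by (auto simp: greedy_def)
  let ?P = "\<lambda>t. \<alpha> \<le> zeta_star (ks @ replicate t 1)"
  define t where "t = (LEAST t. ?P t)"
  have t: "?P t" unfolding t_def using greedy_ones_reach[OF assms] by (rule LeastI_ex)
  then have "t \<noteq> 0" using ks by (intro notI) simp
  then obtain s where s: "t = Suc s" by (cases t) auto
  define d where "d = ks @ replicate s 1"
  have "\<not> ?P s" using not_less_Least[of s ?P] s by (simp add: t_def)
  then have d_less: "zeta_star d < \<alpha>" by (simp add: d_def)
  have d: "admissible d" "d \<noteq> []" "admissible (d @ [1])"
    using ks by (auto simp: d_def admissible_append)
  have ge: "\<alpha> \<le> zeta_star (d @ [1])" using t by (simp add: d_def s replicate_append_same)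
  moreover have "\<alpha> \<noteq> zeta_star (d @ [1])" using assms(2) d(3) by (auto simp: zeta_star_values_def)
  moreover obtain k where "greedy \<alpha> (d @ [k])"
    using greedy_next_digit[OF d(3) d_less] ge by blast
  ultimately show ?thesis using d d_less by (intro exI[of _ d] exI[of _ k]) (auto simp: d_def)
qed

lemma greedy_arbitrarily_long:
  assumes "\<alpha> > 1" and "\<alpha> \<notin> zeta_star_values"
  shows "\<exists>ks. greedy \<alpha> ks \<and> length ks \<ge> n"
proof (induction n)
  case 0
  have "admissible ([] @ [2])" by (simp add: admissible_def)
  \<comment> \<open>The expansion starts from the empty tuple, whose value is 1.\<close>
  then show ?case using greedy_next_digit[of "[]" 2 \<alpha>] assms(1) by (auto simp: zeta_star_Nil)
next
  case (Suc n)
  then obtain ks where ks: "greedy \<alpha> ks" "length ks \<ge> n" by blast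
  then obtain d k where "length d \<ge> length ks" "greedy \<alpha> (d @ [k])"
    using greedy_extend[OF ks(1) assms(2)] by blast
  then show ?case using ks(2) by (intro exI[of _ "d @ [k]"]) simp
qed

section \<open>The approximation criterion\<close>

theorem theorem1p1:
  fixes \<alpha> :: real
  assumes "\<alpha> > 1"
  shows "\<alpha> \<notin> zeta_star_values \<longleftrightarrow>
    infinite {r. r \<ge> 1 \<and> (\<exists>ks. length ks = r \<and> admissible ks \<and>
      \<bar>\<alpha> - zeta_star ks\<bar> < star_sum 2 (ks @ [1]))}"
proof
  assume \<alpha>: "\<alpha> \<notin> zeta_star_values"
  show "infinite {r. r \<ge> 1 \<and> (\<exists>ks. length ks = r \<and> admissible ks \<and>
      \<bar>\<alpha> - zeta_star ks\<bar> < star_sum 2 (ks @ [1]))}"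
    unfolding infinite_nat_iff_unbounded_le
  proof
    fix n
    obtain ks where ks: "greedy \<alpha> ks" "length ks \<ge> n"
      using greedy_arbitrarily_long[OF assms \<alpha>] by blast
    then obtain d where d: "admissible d" "length d \<ge> length ks" "zeta_star d < \<alpha>" "\<alpha> < zeta_star (d @ [1])"
      using greedy_extend[OF ks(1) \<alpha>] by blast
    have "d \<noteq> []" using d(1) by (simp add: admissible_def)
    \<comment> \<open>\<alpha> lies strictly between the values of \<open>d\<close> and
      \<open>d @ [1]\<close>, whose distance is the right-hand side.\<close>
    then have "\<bar>\<alpha> - zeta_star d\<bar> < star_sum 2 (d @ [1])"
      using d zeta_star_snoc[of d 1] by (simp add: admissible_append)
    moreover have "length d \<ge> 1" using \<open>d \<noteq> []\<close> by (cases d) auto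
    ultimately show "\<exists>r\<ge>n. r \<in> {r. r \<ge> 1 \<and> (\<exists>ks. length ks = r \<and> admissible ks \<and>
      \<bar>\<alpha> - zeta_star ks\<bar> < star_sum 2 (ks @ [1]))}"
      using d ks(2) by (intro exI[of _ "length d"]) auto
  qed
next
  assume inf: "infinite {r. r \<ge> 1 \<and> (\<exists>ks. length ks = r \<and> admissible ks \<and>
      \<bar>\<alpha> - zeta_star ks\<bar> < star_sum 2 (ks @ [1]))}"
  show "\<alpha> \<notin> zeta_star_values"
  proof
    assume "\<alpha> \<in> zeta_star_values"
    then obtain l where l: "\<alpha> = zeta_star l" "admissible l" by (auto simp: zeta_star_values_def)
    obtain R where "\<And>ks. admissible ks \<Longrightarrow> length ks \<ge> R \<Longrightarrow> star_sum 2 (ks @ [1]) \<le> \<bar>\<alpha> - zeta_star ks\<bar>"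
      using zeta_star_approximations_bounded_length[OF l(2)] l(1) by blast
    then show False using inf unfolding infinite_nat_iff_unbounded_le by fastforce
  qed
qed

end
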